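(* Let $F:\mathbb{R}^m\to\mathbb{R}^a$ be a vector valued function, where $m\ge1$, $a\ge1$. For a fixed $x\in\mathbb{R}^m$, let $k$ entries of $x$ be observed at random: for a fixed probability distribution $\mathbb{P}$ on $S_m$ and a random $\sigma\sim\mathbb{P}$, the observed tuple is $(\sigma,x_{\sigma(1)},\dots,x_{\sigma(k)})$. (i) A necessary condition for the existence of an unbiased estimator of $F(x)$ that can be constructed from $(\sigma,x_{\sigma(1)},\dots,x_{\sigma(k)})$ (i.e. a function $\hat G$ of the observed tuple with $\mathbb{E}_{\sigma\sim\mathbb{P}}[\hat G(\sigma,x_{\sigma(1)},\dots,x_{\sigma(k)})]=F(x)$ for all $x$) is that it is possible to decompose $F(x)$ over $k$ (or fewer) coordinates of $x$ at a time, i.e. $F$ has the structure $$F(x)=\sum_{(i_1,\dots,i_\ell)}h_{i_1,\dots,i_\ell}(x_{i_1},\dots,x_{i_\ell}),$$ where $\ell\le k$, the sum is over all ordered $\ell$-tuples of distinct elements of $[m]$, and each $h_{i_1,\dots,i_\ell}$ is a function $\mathbb{R}^\ell\to\mathbb{R}^a$. (ii) Moreover, when $F(x)$ can be written in this form with $\ell=k$, an unbiased estimator of $F(x)$ based on $(\sigma,x_{\sigma(1)},\dots,x_{\sigma(k)})$ is $$g(\sigma,x_{\sigma(1)},\dots,x_{\sigma(k)})=\frac{\sum_{(j_1,\dots,j_k)\in S_k}h_{\sigma(j_1),\dots,\sigma(j_k)}(x_{\sigma(j_1)},\dots,x_{\sigma(j_k)})}{\sum_{(j_1,\dots,j_k)\in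 S_k}p(\sigma(j_1),\dots,\sigma(j_k))}.$$
   Context: $[m]=\{1,\dots,m\}$; $S_m$ is the set of permutations of $[m]$; $S_k$ is the set of the $k!$ permutations $(j_1,\dots,j_k)$ of $[k]$. For distinct $j_1,\dots,j_k\in[m]$, $$p(j_1,\dots,j_k)=\sum_{\pi\in S_m}\mathbb{P}(\pi)\,\mathbb{1}(\pi(1)=j_1,\dots,\pi(k)=j_k).$$ The estimator being unbiased means $\mathbb{E}_{\sigma\sim\mathbb{P}}[g(\sigma,x_{\sigma(1)},\dots,x_{\sigma(k)})]=F(x)$.
   Formalization: In (ii) it is assumed that wherever the denominator of g is zero, its numerator vanishes for all observed values (0/0 read as 0); without this (ii) fails, e.g. m=2, k=1, σ always the identity, F(x)=x_2, h_1=0, h_2(t)=t, where E[g]=0. *)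

theory Defs
  imports
    "HOL-Probability.Probability"
    "HOL-Combinatorics.Combinatorics"
begin

text \<open>
  The space \<open>\<real>\<^sup>m\<close> is the set of functions \<open>{1..m} \<rightarrow>\<^sub>E UNIV\<close>, \<open>S\<^sub>m\<close> is the set of \<open>\<sigma>\<close> with
  \<open>\<sigma> permutes {1..m}\<close>, and tuples (of indices or of reals) are lists, so that the entry with
  index \<open>j\<close> of a tuple \<open>y\<close> is \<open>y ! (j - 1)\<close>.
\<close>

definition vecs :: "nat \<Rightarrow> (nat \<Rightarrow> real) set" where
  "vecs m = {1..m} \<rightarrow>\<^sub>E UNIV"

definition observed :: "nat \<Rightarrow> (nat \<Rightarrow> real) \<Rightarrow> (nat \<Rightarrow> nat) \<Rightarrow> real list" where
  "observed k x \<sigma> = map (\<lambda>i. x (\<sigma> i)) [1..<Suc k]"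

definition unbiased_estimator ::
    "nat \<Rightarrow> nat \<Rightarrow> (nat \<Rightarrow> nat) pmf \<Rightarrow> ((nat \<Rightarrow> real) \<Rightarrow> real ^ 'a)
      \<Rightarrow> ((nat \<Rightarrow> nat) \<Rightarrow> real list \<Rightarrow> real ^ 'a) \<Rightarrow> bool" where
  "unbiased_estimator m k P F G \<longleftrightarrow>
     (\<forall>x\<in>vecs m. measure_pmf.expectation P (\<lambda>\<sigma>. G \<sigma> (observed k x \<sigma>)) = F x)"

definition distinct_tuples :: "nat \<Rightarrow> nat \<Rightarrow> nat list set" where
  "distinct_tuples m l = {is. length is = l \<and> distinct is \<and> set is \<subseteq> {1..m}}"

definition decomposes ::
    "nat \<Rightarrow> nat \<Rightarrow> ((nat \<Rightarrow> real) \<Rightarrow> real ^ 'a) \<Rightarrow> (nat list \<Rightarrow> real list \<Rightarrow> real ^ 'a) \<Rightarrow> bool" where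
  "decomposes m l F h \<longleftrightarrow> (\<forall>x\<in>vecs m. F x = (\<Sum>is\<in>distinct_tuples m l. h is (map x is)))"

definition prefix_prob :: "nat \<Rightarrow> nat \<Rightarrow> (nat \<Rightarrow> nat) pmf \<Rightarrow> nat list \<Rightarrow> real" where
  "prefix_prob m k P js =
     (\<Sum>\<pi> | \<pi> permutes {1..m}. pmf P \<pi> * of_bool (map \<pi> [1..<Suc k] = js))"

definition est_num ::
    "nat \<Rightarrow> (nat list \<Rightarrow> real list \<Rightarrow> real ^ 'a) \<Rightarrow> (nat \<Rightarrow> nat) \<Rightarrow> real list \<Rightarrow> real ^ 'a" where
  "est_num k h \<sigma> y =
     (\<Sum>js\<in>permutations_of_set {1..k}. h (map \<sigma> js) (map (\<lambda>j. y ! (j - 1)) js))"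

definition est_den :: "nat \<Rightarrow> nat \<Rightarrow> (nat \<Rightarrow> nat) pmf \<Rightarrow> (nat \<Rightarrow> nat) \<Rightarrow> real" where
  "est_den m k P \<sigma> = (\<Sum>js\<in>permutations_of_set {1..k}. prefix_prob m k P (map \<sigma> js))"

definition estimator ::
    "nat \<Rightarrow> nat \<Rightarrow> (nat \<Rightarrow> nat) pmf \<Rightarrow> (nat list \<Rightarrow> real list \<Rightarrow> real ^ 'a)
      \<Rightarrow> (nat \<Rightarrow> nat) \<Rightarrow> real list \<Rightarrow> real ^ 'a" where
  "estimator m k P h \<sigma> y = est_num k h \<sigma> y /\<^sub>R est_den m k P \<sigma>"

text \<open>
  \<open>est_den m k P \<sigma>\<close> is the probability of observing the index set \<open>\<sigma> ` {1..k}\<close>. If it is zero,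
  \<open>estimator\<close> has the value zero, and the index set contributes nothing to the expectation.
  The numerator is a function of the observed tuple only; at that tuple its summands are
  \<open>h\<close> evaluated at the entries \<open>x (\<sigma> j)\<close>.
\<close>

lemma est_num_observed:
  "est_num k h \<sigma> (observed k x \<sigma>) =
     (\<Sum>js\<in>permutations_of_set {1..k}. h (map \<sigma> js) (map (\<lambda>j. x (\<sigma> j)) js))"
  unfolding est_num_def
proof (rule sum.cong[OF refl])
  fix js assume "js \<in> permutations_of_set {1..k}"
  then have "set js = {1..k}"
    by (simp add: permutations_of_set_def)
  then have "map (\<lambda>j. observed k x \<sigma> ! (j - 1)) js = map (\<lambda>j. x (\<sigma> j)) js"
    by (auto simp: observed_def simp del: upt_Suc)
  then show "h (map \<sigma> js) (map (\<lambda>j. observed k x \<sigma> ! (j - 1)) js) =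
      h (map \<sigma> js) (map (\<lambda>j. x (\<sigma> j)) js)"
    by (rule arg_cong)
qed

end

theory Submission
  imports Defs
begin

text \<open>
  Everything is a finite sum over \<open>S\<^sub>m\<close>. For (i), collecting the terms of the expectation with the
  same observed index tuple gives a decomposition with \<open>\<ell> = k\<close>. For (ii), both the numerator and
  the denominator of the estimator depend on \<open>\<sigma>\<close> only through the index set \<open>A = \<sigma> ` {1..k}\<close>, and
  the denominator is the probability of \<open>A\<close>; so the expectation collects, for each \<open>k\<close>-subset
  \<open>A\<close>, all \<open>h\<close>-terms whose indices enumerate \<open>A\<close>.
\<close>

lemma finite_distinct_tuples: "finite (distinct_tuples m l)"
  by (rule finite_subset[OF _ finite_lists_length_eq[of "{1..m}" l]])
    (auto simp: distinct_tuples_def)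

lemma map_permutes_in_distinct_tuples:
  assumes "k \<le> m" "\<sigma> permutes {1..m}"
  shows "map \<sigma> [1..<Suc k] \<in> distinct_tuples m k"
proof -
  have "\<sigma> ` {1..k} \<subseteq> {1..m}"
    using assms permutes_image[OF assms(2)] by fastforce
  then show ?thesis
    using permutes_inj_on[OF assms(2)]
    by (auto simp: distinct_tuples_def distinct_map atLeastLessThanSuc_atLeastAtMost
      simp del: upt_Suc)
qed

lemma expectation_permutes:
  fixes f :: "(nat \<Rightarrow> nat) \<Rightarrow> real ^ 'a"
  assumes "set_pmf P \<subseteq> {\<sigma>. \<sigma> permutes {1..m}}"
  shows "measure_pmf.expectation P f = (\<Sum>\<sigma> | \<sigma> permutes {1..m}. pmf P \<sigma> *\<^sub>R f \<sigma>)"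
  using assms by (intro integral_measure_pmf) (auto simp: finite_permutations)

text \<open>The witness is the part of the expectation in which the observed indices are
  \<open>is\<close>. There the observed values are \<open>map x is\<close>, so each summand reads
  \<open>x\<close> only at those \<open>k\<close> indices.\<close>

lemma unbiased_estimator_imp_decomposes:
  fixes F :: "(nat \<Rightarrow> real) \<Rightarrow> real ^ 'a"
  assumes "k \<le> m" and P: "set_pmf P \<subseteq> {\<sigma>. \<sigma> permutes {1..m}}"
    and G: "unbiased_estimator m k P F G"
  shows "decomposes m k F
    (\<lambda>is y. \<Sum>\<sigma> | \<sigma> permutes {1..m} \<and> map \<sigma> [1..<Suc k] = is. pmf P \<sigma> *\<^sub>R G \<sigma> y)"
  unfolding decomposes_def
proof
  fix x assume "x \<in> vecs m"
  then have "F x = (\<Sum>\<sigma> | \<sigma> permutes {1..m}. pmf P \<sigma> *\<^sub>R G \<sigma> (observed k x \<sigma>))"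
    using G by (simp add: unbiased_estimator_def expectation_permutes[OF P])
  also have "\<dots> = (\<Sum>is\<in>distinct_tuples m k.
      \<Sum>\<sigma> | \<sigma> \<in> {\<sigma>. \<sigma> permutes {1..m}} \<and> map \<sigma> [1..<Suc k] = is.
        pmf P \<sigma> *\<^sub>R G \<sigma> (observed k x \<sigma>))"
    by (rule sum.group[symmetric])
      (use map_permutes_in_distinct_tuples[OF \<open>k \<le> m\<close>] finite_distinct_tuples in
        \<open>auto simp: finite_permutations simp del: upt_Suc\<close>)
  also have "\<dots> = (\<Sum>is\<in>distinct_tuples m k.
      \<Sum>\<sigma> | \<sigma> permutes {1..m} \<and> map \<sigma> [1..<Suc k] = is. pmf P \<sigma> *\<^sub>R G \<sigma> (map x is))"
    by (intro sum.cong refl) (auto simp: observed_def comp_def simp del: upt_Suc)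
  finally show "F x = \<dots>" .
qed

text \<open>With \<open>A = {1..k}\<close> and \<open>f = \<sigma>\<close>, the right side is the
  shape of the sums in the estimator, while the left side sees only the image set.\<close>

lemma sum_permutations_of_set_image:
  assumes "inj f"
  shows "(\<Sum>is\<in>permutations_of_set (f ` A). g is) = (\<Sum>js\<in>permutations_of_set A. g (map f js))"
proof -
  have "inj_on (map f) (permutations_of_set A)"
    using assms by (meson inj_mapI inj_on_subset subset_UNIV)
  then show ?thesis
    using permutations_of_set_image_inj[OF inj_on_subset[OF assms subset_UNIV]]
    by (simp add: sum.reindex)
qed

lemma est_den_eq:
  assumes \<sigma>: "\<sigma> permutes {1..m}"
  shows "est_den m k P \<sigma> = (\<Sum>\<pi> | \<pi> permutes {1..m} \<and> \<pi> ` {1..k} = \<sigma> ` {1..k}. pmf P \<pi>)"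
proof -
  have "est_den m k P \<sigma> = (\<Sum>is\<in>permutations_of_set (\<sigma> ` {1..k}). prefix_prob m k P is)"
    unfolding est_den_def by (rule sum_permutations_of_set_image[OF permutes_inj[OF \<sigma>], symmetric])
  also have "\<dots> = (\<Sum>\<pi> | \<pi> permutes {1..m}.
      \<Sum>is\<in>permutations_of_set (\<sigma> ` {1..k}). pmf P \<pi> * of_bool (map \<pi> [1..<Suc k] = is))"
    unfolding prefix_prob_def by (rule sum.swap)
  also have "\<dots> = (\<Sum>\<pi> | \<pi> permutes {1..m}.
      if \<pi> ` {1..k} = \<sigma> ` {1..k} then pmf P \<pi> else 0)"
  proof (rule sum.cong[OF refl])
    fix \<pi> assume "\<pi> \<in> {\<pi>. \<pi> permutes {1..m}}"
    then have "inj_on \<pi> {1..k}"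
      using permutes_inj_on by blast
    then have "map \<pi> [1..<Suc k] \<in> permutations_of_set (\<sigma> ` {1..k}) \<longleftrightarrow> \<pi> ` {1..k} = \<sigma> ` {1..k}"
      by (simp add: permutations_of_set_def distinct_map atLeastLessThanSuc_atLeastAtMost
        del: upt_Suc)
    then show "(\<Sum>is\<in>permutations_of_set (\<sigma> ` {1..k}).
        pmf P \<pi> * of_bool (map \<pi> [1..<Suc k] = is)) =
      (if \<pi> ` {1..k} = \<sigma> ` {1..k} then pmf P \<pi> else 0)"
      by (simp add: of_bool_def if_distrib sum.delta cong: if_cong del: upt_Suc)
  qed
  also have "\<dots> = (\<Sum>\<pi> | \<pi> permutes {1..m} \<and> \<pi> ` {1..k} = \<sigma> ` {1..k}. pmf P \<pi>)"
    by (subst sum.inter_filter[symmetric]) (simp_all add: finite_permutations)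
  finally show ?thesis .
qed

lemma est_num_observed_eq:
  assumes \<sigma>: "\<sigma> permutes {1..m}"
  shows "est_num k h \<sigma> (observed k x \<sigma>) =
    (\<Sum>is\<in>permutations_of_set (\<sigma> ` {1..k}). h is (map x is))"
  unfolding est_num_observed sum_permutations_of_set_image[OF permutes_inj[OF \<sigma>]]
  by (simp add: comp_def)

text \<open>A bijection from \<open>A\<close> to \<open>B\<close> is glued to one between the
  complements in \<open>S\<close>. This provides every \<open>k\<close>-subset of the indices with a
  permutation that would reveal it, even when the subset has probability zero.\<close>

lemma ex_permutes_image_eq:
  assumes "finite S" "A \<subseteq> S" "B \<subseteq> S" "card A = card B"
  shows "\<exists>\<sigma>. \<sigma> permutes S \<and> \<sigma> ` A = B"
proof -
  have fin: "finite A" "finite B"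
    using assms finite_subset by blast+
  obtain f where f: "bij_betw f A B"
    using finite_same_card_bij[OF fin assms(4)] by blast
  have "card (S - A) = card (S - B)"
    using assms fin by (simp add: card_Diff_subset)
  then obtain g where g: "bij_betw g (S - A) (S - B)"
    using finite_same_card_bij[of "S - A" "S - B"] assms(1) by blast
  \<comment> \<open>\<open>permutes\<close> also demands the identity outside \<open>S\<close>,
    hence the last branch.\<close>
  define \<sigma> where "\<sigma> = (\<lambda>s. if s \<in> A then f s else if s \<in> S then g s else s)"
  have "bij_betw \<sigma> A B"
    using f by (rule bij_betw_cong[THEN iffD1, rotated]) (simp add: \<sigma>_def)
  moreover have "bij_betw \<sigma> (S - A) (S - B)"
    using g by (rule bij_betw_cong[THEN iffD1, rotated]) (simp add: \<sigma>_def)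
  ultimately have "bij_betw \<sigma> (A \<union> (S - A)) (B \<union> (S - B))"
    by (rule bij_betw_combine) blast
  then have "bij_betw \<sigma> S S"
    using assms by (simp add: Un_absorb1)
  then have "\<sigma> permutes S"
    using assms(2) by (intro bij_imp_permutes) (auto simp: \<sigma>_def)
  with \<open>bij_betw \<sigma> A B\<close> show ?thesis
    by (auto simp: bij_betw_def)
qed

text \<open>A tuple of distinct indices is an ordering of exactly one set, the set of its
  entries.\<close>

lemma sum_distinct_tuples:
  fixes f :: "nat list \<Rightarrow> 'b::comm_monoid_add"
  shows "(\<Sum>is\<in>distinct_tuples m k. f is) =
    (\<Sum>A | A \<subseteq> {1..m} \<and> card A = k. \<Sum>is\<in>permutations_of_set A. f is)"
proof -
  have "(\<Sum>is\<in>distinct_tuples m k. f is) =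
    (\<Sum>A | A \<subseteq> {1..m} \<and> card A = k. \<Sum>is | is \<in> distinct_tuples m k \<and> set is = A. f is)"
    by (rule sum.group[OF finite_distinct_tuples, symmetric])
      (auto simp: distinct_tuples_def distinct_card)
  also have "\<dots> = (\<Sum>A | A \<subseteq> {1..m} \<and> card A = k. \<Sum>is\<in>permutations_of_set A. f is)"
    by (intro sum.cong refl)
      (auto simp: distinct_tuples_def permutations_of_set_def distinct_card)
  finally show ?thesis .
qed

text \<open>Index sets of probability zero are lost in the expectation, while \<open>F\<close> still
  contains their \<open>h\<close>-terms; \<open>null\<close> makes those terms cancel within each
  such set.\<close>

lemma decomposes_imp_unbiased_estimator:
  fixes F :: "(nat \<Rightarrow> real) \<Rightarrow> real ^ 'a"
  assumes "k \<le> m" and P: "set_pmf P \<subseteq> {\<sigma>. \<sigma> permutes {1..m}}"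
    and h: "decomposes m k F h"
    and null: "\<And>\<sigma> y. \<sigma> permutes {1..m} \<Longrightarrow> est_den m k P \<sigma> = 0 \<Longrightarrow> length y = k \<Longrightarrow>
      est_num k h \<sigma> y = 0"
  shows "unbiased_estimator m k P F (estimator m k P h)"
  unfolding unbiased_estimator_def
proof
  fix x assume x: "x \<in> vecs m"
  let ?E = "\<lambda>\<sigma>. estimator m k P h \<sigma> (observed k x \<sigma>)"
  let ?N = "\<lambda>A. \<Sum>is\<in>permutations_of_set A. h is (map x is)"
  have "measure_pmf.expectation P ?E = (\<Sum>\<sigma> | \<sigma> permutes {1..m}. pmf P \<sigma> *\<^sub>R ?E \<sigma>)"
    by (rule expectation_permutes[OF P])
  also have "\<dots> = (\<Sum>A | A \<subseteq> {1..m} \<and> card A = k.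
      \<Sum>\<sigma> | \<sigma> \<in> {\<sigma>. \<sigma> permutes {1..m}} \<and> \<sigma> ` {1..k} = A. pmf P \<sigma> *\<^sub>R ?E \<sigma>)"
  proof (rule sum.group[symmetric])
    have "\<sigma> ` {1..k} \<subseteq> {1..m} \<and> card (\<sigma> ` {1..k}) = k" if "\<sigma> permutes {1..m}" for \<sigma>
      using \<open>k \<le> m\<close> permutes_image[OF that] card_image[OF permutes_inj_on[OF that, of "{1..k}"]]
      by fastforce
    then show "(\<lambda>\<sigma>. \<sigma> ` {1..k}) ` {\<sigma>. \<sigma> permutes {1..m}} \<subseteq> {A. A \<subseteq> {1..m} \<and> card A = k}"
      by blast
  qed (auto simp: finite_permutations)
  also have "\<dots> = (\<Sum>A | A \<subseteq> {1..m} \<and> card A = k. ?N A)"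
  proof (rule sum.cong[OF refl])
    fix A assume "A \<in> {A. A \<subseteq> {1..m} \<and> card A = k}"
    \<comment> \<open>\<tau> represents \<open>A\<close> independently of \<open>P\<close>, so that
      \<open>null\<close> can be applied to a set that is never observed.\<close>
    then obtain \<tau> where \<tau>: "\<tau> permutes {1..m}" "\<tau> ` {1..k} = A"
      using ex_permutes_image_eq[of "{1..m}" "{1..k}" A] \<open>k \<le> m\<close> by auto
    let ?q = "\<Sum>\<sigma> | \<sigma> permutes {1..m} \<and> \<sigma> ` {1..k} = A. pmf P \<sigma>"
    have "(\<Sum>\<sigma> | \<sigma> \<in> {\<sigma>. \<sigma> permutes {1..m}} \<and> \<sigma> ` {1..k} = A. pmf P \<sigma> *\<^sub>R ?E \<sigma>) =
        (\<Sum>\<sigma> | \<sigma> permutes {1..m} \<and> \<sigma> ` {1..k} = A. pmf P \<sigma> *\<^sub>R (?N A /\<^sub>R ?q))"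
      \<comment> \<open>On this group the estimator is constant, so the total weight
        \<open>?q\<close> can be factored out next.\<close>
      by (intro sum.cong) (auto simp: estimator_def est_num_observed_eq est_den_eq)
    also have "\<dots> = ?q *\<^sub>R (?N A /\<^sub>R ?q)"
      by (rule scaleR_sum_left[symmetric])
    also have "\<dots> = ?N A"
    \<comment> \<open>For \<open>?q = 0\<close> the left side is zero and \<open>?N A\<close> must
      vanish too; otherwise \<open>?q\<close> cancels.\<close>
    proof (cases "?q = 0")
      case True
      then have "est_num k h \<tau> (observed k x \<tau>) = 0"
        using \<tau> by (intro null) (simp_all add: est_den_eq observed_def)
      then have "?N A = 0"
        using \<tau> by (simp add: est_num_observed_eq)
      then show ?thesis
        by simp
    qed simp
    finally show "(\<Sum>\<sigma> | \<sigma> \<in> {\<sigma>. \<sigma> permutes {1..m}} \<and> \<sigma> ` {1..k} = A. pmf P \<sigma> *\<^sub>R ?E \<sigma>) =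
      ?N A" .
  qed
  also have "\<dots> = F x"
    using h x by (simp add: decomposes_def sum_distinct_tuples)
  finally show "measure_pmf.expectation P ?E = F x" .
qed

theorem lemma1:
  fixes m k :: nat
    and P :: "(nat \<Rightarrow> nat) pmf"
    and F :: "(nat \<Rightarrow> real) \<Rightarrow> real ^ 'a"
  assumes "1 \<le> m" and "k \<le> m"
    and "set_pmf P \<subseteq> {\<sigma>. \<sigma> permutes {1..m}}"
  shows "((\<exists>G. unbiased_estimator m k P F G) \<longrightarrow> (\<exists>l\<le>k. \<exists>h. decomposes m l F h)) \<and>
    (\<forall>h. decomposes m k F h \<longrightarrow>
      (\<forall>\<sigma>. \<sigma> permutes {1..m} \<longrightarrow> est_den m k P \<sigma> = 0 \<longrightarrow>
        (\<forall>y. length y = k \<longrightarrow> est_num k h \<sigma> y = 0)) \<longrightarrow>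
      unbiased_estimator m k P F (estimator m k P h))"
  \<comment> \<open>The first half takes \<open>l = k\<close>.\<close>
  using unbiased_estimator_imp_decomposes[OF assms(2,3)]
    decomposes_imp_unbiased_estimator[OF assms(2,3)]
  by blast

end
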